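(* Let $1\le n\le N$, and let $\Lambda$ be a positive definite diagonal $N\times N$ real matrix. The geodesic flow on the Stiefel manifold $V(n,N)$ given by the variational problem $$\min_{Q(\cdot)}\int_0^T \tfrac12\operatorname{Tr}\big(\Lambda\,\dot Q^{\mathsf T}\dot Q\big)\,dt,\qquad Q(t)\in V(n,N),\ Q(0)=Q_0,\ Q(T)=Q_T,$$ is, in terms of $Q$ and $S=\dot Q\Lambda$, of the form $$\dot Q=S\Lambda^{-1},\qquad \dot S=BQ,$$ where $$B=\widetilde{J_Q}^{-1}(E),\qquad E=-2\dot Q\dot Q^{\mathsf T}=-2S\Lambda^{-2}S^{\mathsf T},$$ and $\widetilde{J_Q}:\mathrm{Sym}(n)\to\mathrm{Sym}(n)$ is given by $$\widetilde{J_Q}(B)=(Q\Lambda^{-1}Q^{\mathsf T})B+B(Q\Lambda^{-1}Q^{\mathsf T}).$$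
   Context: $\mathbb R^{nN}$ denotes the real $n\times N$ matrices, $V(n,N)=\{Q\in\mathbb R^{nN}: QQ^{\mathsf T}=I_n\}$, and $\mathrm{Sym}(n)$ is the space of real symmetric $n\times n$ matrices. The geodesic flow consists of the extremals of the problem: smooth curves $Q(t)\in V(n,N)$ at which the first variation of the integral vanishes for all fixed-endpoint variations tangent to $V(n,N)$, i.e. $\delta Q=Q\Sigma$ with $\Sigma(t)$ real skew-symmetric $N\times N$, smooth, and $\Sigma(0)=\Sigma(T)=0$. Writing $\dot Q=QU$ with $U$ skew-symmetric, $S=QU\Lambda=\dot Q\Lambda$. *)

theory Defs
  imports "HOL-Analysis.Analysis"
begin

definition diagonal_matrix :: "real^'n^'n \<Rightarrow> bool" where
  "diagonal_matrix A \<longleftrightarrow> (\<forall>i j. i \<noteq> j \<longrightarrow> A $ i $ j = 0)"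

definition positive_definite :: "real^'n^'n \<Rightarrow> bool" where
  "positive_definite A \<longleftrightarrow> transpose A = A \<and> (\<forall>x. x \<noteq> 0 \<longrightarrow> 0 < x \<bullet> (A *v x))"

definition skew_symmetric :: "real^'n^'n \<Rightarrow> bool" where
  "skew_symmetric A \<longleftrightarrow> transpose A = - A"

definition Sym :: "(real^'n^'n) set" where
  "Sym = {A. transpose A = A}"

definition stiefel :: "(real^'N^'n) set" where
  "stiefel = {Q. Q ** transpose Q = mat 1}"

text \<open>Derivatives are taken within the interval, hence one-sided at its endpoints;
  \<open>D k\<close> is the \<open>k\<close>-th derivative.\<close>

definition smooth_curve :: "real \<Rightarrow> (real \<Rightarrow> 'a::real_normed_vector) \<Rightarrow> bool" where
  "smooth_curve T f \<longleftrightarrow>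
     (\<exists>D :: nat \<Rightarrow> real \<Rightarrow> 'a. D 0 = f \<and>
        (\<forall>k. \<forall>t\<in>{0..T}. (D k has_vector_derivative D (Suc k) t) (at t within {0..T})))"

definition velocity :: "real \<Rightarrow> (real \<Rightarrow> 'a::real_normed_vector) \<Rightarrow> real \<Rightarrow> 'a" where
  "velocity T f t = vector_derivative f (at t within {0..T})"

definition action :: "real^'N^'N \<Rightarrow> real \<Rightarrow> (real \<Rightarrow> real^'N^'n) \<Rightarrow> real" where
  "action \<Lambda> T Q =
     integral {0..T} (\<lambda>t. 1/2 * trace (\<Lambda> ** transpose (velocity T Q t) ** velocity T Q t))"

definition admissible ::
  "real \<Rightarrow> real^'N^'n \<Rightarrow> real^'N^'n \<Rightarrow> (real \<Rightarrow> real^'N^'n) \<Rightarrow> bool" where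
  "admissible T Q\<^sub>0 Q\<^sub>T Q \<longleftrightarrow>
     smooth_curve T Q \<and> (\<forall>t\<in>{0..T}. Q t \<in> stiefel) \<and> Q 0 = Q\<^sub>0 \<and> Q T = Q\<^sub>T"

text \<open>The action is defined on all smooth curves of matrices, so its first variation at \<open>Q\<close>
  along \<open>\<delta>Q = Q\<Sigma>\<close> is the derivative at \<open>\<epsilon> = 0\<close> of its value at \<open>Q + \<epsilon> \<delta>Q\<close>. Only the direction
  \<open>\<delta>Q\<close> is tangent to the Stiefel manifold; the varied curve itself need not stay in it.\<close>

definition extremal ::
  "real^'N^'N \<Rightarrow> real \<Rightarrow> real^'N^'n \<Rightarrow> real^'N^'n \<Rightarrow> (real \<Rightarrow> real^'N^'n) \<Rightarrow> bool" where
  "extremal \<Lambda> T Q\<^sub>0 Q\<^sub>T Q \<longleftrightarrow>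
     admissible T Q\<^sub>0 Q\<^sub>T Q \<and>
     (\<forall>\<Sigma> :: real \<Rightarrow> real^'N^'N.
        smooth_curve T \<Sigma> \<and> (\<forall>t\<in>{0..T}. skew_symmetric (\<Sigma> t)) \<and> \<Sigma> 0 = 0 \<and> \<Sigma> T = 0 \<longrightarrow>
        ((\<lambda>\<epsilon>. action \<Lambda> T (\<lambda>t. Q t + \<epsilon> *\<^sub>R (Q t ** \<Sigma> t))) has_real_derivative 0) (at 0))"

definition J_op :: "real^'N^'N \<Rightarrow> real^'N^'n \<Rightarrow> real^'n^'n \<Rightarrow> real^'n^'n" where
  "J_op \<Lambda> Q B =
     (Q ** matrix_inv \<Lambda> ** transpose Q) ** B + B ** (Q ** matrix_inv \<Lambda> ** transpose Q)"

definition E_mat :: "real^'N^'N \<Rightarrow> real^'N^'n \<Rightarrow> real^'n^'n" where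
  "E_mat \<Lambda> S = - 2 *\<^sub>R (S ** (matrix_inv \<Lambda> ** matrix_inv \<Lambda>) ** transpose S)"

definition B_mat :: "real^'N^'N \<Rightarrow> real^'N^'n \<Rightarrow> real^'N^'n \<Rightarrow> real^'n^'n" where
  "B_mat \<Lambda> Q S = inv_into Sym (J_op \<Lambda> Q) (E_mat \<Lambda> S)"

end

theory Submission
  imports Defs
begin

text \<open>Integrating the first variation by parts, with \<open>S = Q'\<Lambda>\<close>, gives minus the integral of the
  Frobenius product of \<open>Q\<^sup>T S'\<close> and \<open>\<Sigma>\<close>. It vanishes for all skew-symmetric \<open>\<Sigma>\<close> iff \<open>Q\<^sup>T S'\<close> is
  symmetric: no bump functions are needed, since \<open>t (T - t)\<close> times the skew part of \<open>Q\<^sup>T S'\<close> is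
  itself a smooth variation. As \<open>Q Q\<^sup>T = 1\<close>, symmetry of \<open>Q\<^sup>T S'\<close> means \<open>S' = B Q\<close> with
  \<open>B = Q S'\<^sup>T\<close> symmetric. Differentiating \<open>Q Q\<^sup>T = 1\<close> twice then identifies \<open>B\<close> by \<open>J\<^sub>Q(B) = E\<close>,
  and \<open>J\<^sub>Q\<close> is injective because its quadratic form is positive definite.\<close>

section \<open>Matrix products, transposes and the Frobenius inner product\<close>

interpretation matrix_mult: bounded_bilinear
  "(**) :: real^'m^'n \<Rightarrow> real^'k^'m \<Rightarrow> real^'k^'n"
proof -
  have "bilinear ((**) :: real^'m^'n \<Rightarrow> real^'k^'m \<Rightarrow> real^'k^'n)"
    unfolding bilinear_def linear_iff matrix_matrix_mult_def
    by (simp add: vec_eq_iff algebra_simps sum.distrib sum_distrib_left)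
  then show "bounded_bilinear ((**) :: real^'m^'n \<Rightarrow> real^'k^'m \<Rightarrow> real^'k^'n)"
    by (simp add: bilinear_conv_bounded_bilinear)
qed

lemma bounded_linear_transpose: "bounded_linear (transpose :: real^'m^'n \<Rightarrow> real^'n^'m)"
  by (simp flip: linear_conv_bounded_linear add: linear_iff transpose_def vec_eq_iff)

lemma transpose_add: "transpose (A + B) = transpose A + transpose (B :: real^'m^'n)"
  and transpose_minus: "transpose (- B) = - transpose B"
  and transpose_diff: "transpose (A - B) = transpose A - transpose (B :: real^'m^'n)"
  by (simp_all add: transpose_def vec_eq_iff)

lemma inner_transpose: "transpose A \<bullet> transpose B = A \<bullet> (B :: real^'m^'n)"
  unfolding inner_vec_def transpose_def by simp (rule sum.swap)

lemma trace_transpose_mult: "trace (transpose A ** B) = A \<bullet> (B :: real^'m^'n)"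
  unfolding trace_def matrix_matrix_mult_def transpose_def inner_vec_def
  by simp (rule sum.swap)

lemma inner_matrix_mult_left: "(A ** B) \<bullet> C = B \<bullet> (transpose A ** C)"
  for A :: "real^'m^'n" and B :: "real^'k^'m"
  by (simp flip: trace_transpose_mult add: matrix_transpose_mul matrix_mul_assoc)

lemma inner_matrix_mult_right: "(A ** B) \<bullet> C = A \<bullet> (C ** transpose B)"
  for A :: "real^'m^'n" and B :: "real^'k^'m"
  using inner_matrix_mult_left[of "transpose B" "transpose A" "transpose C"]
    inner_transpose[of "A ** B" C] inner_transpose[of A "C ** transpose B"]
  by (simp add: matrix_transpose_mul)

text \<open>Transposing both factors preserves the product but flips the sign of \<open>B\<close>,
  so the product equals its own negative.\<close>

lemma inner_symmetric_skew:
  fixes A B :: "real^'n^'n"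
  assumes "transpose A = A" "transpose B = - B"
  shows "A \<bullet> B = 0"
  using inner_transpose[of A B] assms by simp

section \<open>Positive definite matrices\<close>

lemma positive_definite_inner_mult_pos:
  fixes M :: "real^'n^'n" and A :: "real^'m^'n"
  assumes "positive_definite M" "A \<noteq> 0"
  shows "0 < A \<bullet> (M ** A)"
proof -
  \<comment> \<open>The Frobenius form of \<open>M\<close> splits into the vector forms of
    \<open>M\<close> at the columns of \<open>A\<close>; one nonzero column makes the sum
    positive.\<close>
  have eq: "A \<bullet> (M ** A) = (\<Sum>j\<in>UNIV. column j A \<bullet> (M *v column j A))"
    unfolding inner_vec_def column_def matrix_matrix_mult_def matrix_vector_mult_def
    by simp (rule sum.swap)
  obtain j where "column j A \<noteq> 0"
    using assms(2) by (auto simp: vec_eq_iff column_def)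
  then have "0 < column j A \<bullet> (M *v column j A)"
    using assms(1) by (simp add: positive_definite_def)
  moreover have "0 \<le> column i A \<bullet> (M *v column i A)" for i
    using assms(1) by (cases "column i A = 0") (auto simp: positive_definite_def intro: less_imp_le)
  ultimately show ?thesis
    unfolding eq by (intro sum_pos2[of _ j]) auto
qed

lemma positive_definite_mult_inv:
  fixes M :: "real^'n^'n"
  assumes "positive_definite M"
  shows "M ** matrix_inv M = mat 1" "matrix_inv M ** M = mat 1"
proof -
  have "inj ((*v) M)"
    using assms unfolding positive_definite_def linear_injective_0[OF matrix_vector_mul_linear]
    by (metis inner_zero_right less_irrefl)
  then have "invertible M"
    by (simp add: invertible_left_inverse matrix_left_invertible_injective)
  \<comment> \<open>\<open>matrix_inv\<close> is a Hilbert choice, so its defining property follows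
    once some inverse exists.\<close>
  then have "M ** matrix_inv M = mat 1 \<and> matrix_inv M ** M = mat 1"
    unfolding invertible_def matrix_inv_def by (rule someI_ex)
  then show "M ** matrix_inv M = mat 1" "matrix_inv M ** M = mat 1"
    by simp_all
qed

text \<open>The substitution \<open>x = M y\<close> turns the form of the inverse at
  \<open>x\<close> into the form of \<open>M\<close> at \<open>y\<close>. Symmetry holds because a
  left and a right inverse of the same matrix coincide.\<close>

lemma positive_definite_matrix_inv:
  fixes M :: "real^'n^'n"
  assumes "positive_definite M"
  shows "positive_definite (matrix_inv M)"
  unfolding positive_definite_def
proof safe
  note inv = positive_definite_mult_inv[OF assms]
  have "transpose M = M"
    using assms by (simp add: positive_definite_def)
  then have "transpose (matrix_inv M) ** M = mat 1"
    by (metis inv(1) matrix_transpose_mul transpose_mat)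
  then show "transpose (matrix_inv M) = matrix_inv M"
    by (metis inv(1) matrix_mul_assoc matrix_mul_lid matrix_mul_rid)
next
  fix x :: "real^'n" assume "x \<noteq> 0"
  note inv = positive_definite_mult_inv[OF assms]
  let ?y = "matrix_inv M *v x"
  have x: "M *v ?y = x"
    by (simp add: matrix_vector_mul_assoc inv)
  with \<open>x \<noteq> 0\<close> have "?y \<noteq> 0" by (metis matrix_vector_mult_0_right)
  then have "0 < ?y \<bullet> (M *v ?y)"
    using assms by (simp add: positive_definite_def)
  then show "0 < x \<bullet> ?y"
    by (simp add: x inner_commute)
qed

text \<open>The form at \<open>x\<close> is that of \<open>M\<close> at
  \<open>transpose Q *v x\<close>, and this vector is nonzero because \<open>Q\<close> recovers
  \<open>x\<close> from it.\<close>

lemma positive_definite_congruence: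
  fixes M :: "real^'N^'N" and Q :: "real^'N^'n"
  assumes "positive_definite M" "Q \<in> stiefel"
  shows "positive_definite (Q ** M ** transpose Q)"
  unfolding positive_definite_def
proof safe
  show "transpose (Q ** M ** transpose Q) = Q ** M ** transpose Q"
    using assms(1) by (simp add: positive_definite_def matrix_transpose_mul matrix_mul_assoc)
next
  fix x :: "real^'n" assume "x \<noteq> 0"
  let ?y = "transpose Q *v x"
  have "Q *v ?y = x"
    using assms(2) by (simp add: stiefel_def matrix_vector_mul_assoc del: transpose_matrix_vector)
  with \<open>x \<noteq> 0\<close> have "?y \<noteq> 0" by (metis matrix_vector_mult_0_right)
  then have "0 < ?y \<bullet> (M *v ?y)"
    using assms(1) by (simp add: positive_definite_def)
  then show "0 < x \<bullet> ((Q ** M ** transpose Q) *v x)"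
    by (simp add: dot_lmul_matrix flip: matrix_vector_mul_assoc)
qed

section \<open>The operator \<open>J_op\<close> and its inverse on symmetric matrices\<close>

lemma J_op_inner_pos:
  assumes "positive_definite \<Lambda>" "Q \<in> stiefel" "B \<noteq> 0"
  shows "0 < B \<bullet> J_op \<Lambda> Q B"
proof -
  define P where "P = Q ** matrix_inv \<Lambda> ** transpose Q"
  have P: "positive_definite P"
    unfolding P_def using assms by (intro positive_definite_congruence positive_definite_matrix_inv)
  \<comment> \<open>Transposing turns the right multiplication by \<open>P\<close> into a left one,
    so both summands of \<open>J_op\<close> are covered by the same positivity lemma.\<close>
  have "B \<bullet> (B ** P) = transpose B \<bullet> (P ** transpose B)"
    using P by (metis inner_transpose matrix_transpose_mul positive_definite_def)
  also have "\<dots> > 0"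
    using P assms(3) by (intro positive_definite_inner_mult_pos) (auto simp: transpose_def vec_eq_iff)
  finally show ?thesis
    using positive_definite_inner_mult_pos[OF P assms(3)]
    by (simp add: J_op_def P_def inner_add_right)
qed

text \<open>The conjugated inverse of \<Lambda> is symmetric, so transposition only exchanges the
  two summands.\<close>

lemma transpose_J_op:
  assumes "positive_definite \<Lambda>"
  shows "transpose (J_op \<Lambda> Q B) = J_op \<Lambda> Q (transpose B)"
  using positive_definite_matrix_inv[OF assms]
  by (simp add: J_op_def transpose_add matrix_transpose_mul matrix_mul_assoc
      positive_definite_def add.commute)

text \<open>Positivity holds on all square matrices, which gives injectivity there and, by finite
  dimension, surjectivity. Since \<open>J_op\<close> commutes with transposition, injectivity forces
  the preimage of a symmetric matrix to be symmetric.\<close>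

lemma bij_betw_J_op:
  fixes \<Lambda> :: "real^'N^'N" and Q :: "real^'N^'n"
  assumes "positive_definite \<Lambda>" "Q \<in> stiefel"
  shows "bij_betw (J_op \<Lambda> Q) Sym Sym"
proof -
  have lin: "linear (J_op \<Lambda> Q)"
    by (simp add: linear_iff J_op_def matrix_mult.add_left matrix_mult.add_right
        matrix_mult.scaleR_left matrix_mult.scaleR_right scaleR_add_right)
  have inj: "inj (J_op \<Lambda> Q)"
    using J_op_inner_pos[OF assms] lin
    by (metis inner_zero_right less_irrefl linear_injective_0)
  then have surj: "surj (J_op \<Lambda> Q)"
    using lin linear_injective_imp_surjective by blast
  have "transpose B = B" if "transpose (J_op \<Lambda> Q B) = J_op \<Lambda> Q B" for B
    using that inj by (simp add: transpose_J_op assms(1) inj_eq)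
  then have "J_op \<Lambda> Q ` Sym = Sym"
    using surj transpose_J_op[OF assms(1), of Q] unfolding Sym_def
    by (auto simp: image_iff) (metis surjD)
  then show ?thesis
    using inj_on_subset[OF inj subset_UNIV] by (simp add: bij_betw_def)
qed

section \<open>Calculus of smooth curves on a closed interval\<close>

lemma smooth_curve_derivE:
  assumes "smooth_curve T f"
  obtains f' where "smooth_curve T f'"
    "\<And>t. t \<in> {0..T} \<Longrightarrow> (f has_vector_derivative f' t) (at t within {0..T})"
proof -
  obtain D where D: "D 0 = f"
    "\<And>k t. t \<in> {0..T} \<Longrightarrow> (D k has_vector_derivative D (Suc k) t) (at t within {0..T})"
    using assms unfolding smooth_curve_def by blast
  then have "smooth_curve T (D 1)"
    unfolding smooth_curve_def by (intro exI[of _ "\<lambda>k. D (Suc k)"]) auto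
  with D show thesis
    by (intro that[of "D 1"]) (auto simp flip: D(1))
qed

lemma smooth_curve_imp_continuous_on:
  "smooth_curve T f \<Longrightarrow> continuous_on {0..T} f"
  by (metis smooth_curve_derivE continuous_on_vector_derivative)

lemma smooth_curve_bounded_linear:
  assumes "bounded_linear h" "smooth_curve T f"
  shows "smooth_curve T (\<lambda>t. h (f t))"
proof -
  obtain D where D: "D 0 = f"
    "\<And>k t. t \<in> {0..T} \<Longrightarrow> (D k has_vector_derivative D (Suc k) t) (at t within {0..T})"
    using assms unfolding smooth_curve_def by blast
  then show ?thesis
    unfolding smooth_curve_def
    by (intro exI[of _ "\<lambda>k t. h (D k t)"]) (auto intro: bounded_linear.has_vector_derivative[OF assms(1)])
qed

lemma smooth_curve_diff:
  assumes "smooth_curve T f" "smooth_curve T g"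
  shows "smooth_curve T (\<lambda>t. f t - g t)"
proof -
  obtain D where D: "D 0 = f"
    "\<And>k t. t \<in> {0..T} \<Longrightarrow> (D k has_vector_derivative D (Suc k) t) (at t within {0..T})"
    using assms unfolding smooth_curve_def by blast
  obtain E where E: "E 0 = g"
    "\<And>k t. t \<in> {0..T} \<Longrightarrow> (E k has_vector_derivative E (Suc k) t) (at t within {0..T})"
    using assms unfolding smooth_curve_def by blast
  show ?thesis
    unfolding smooth_curve_def using D E
    by (intro exI[of _ "\<lambda>k t. D k t - E k t"]) (auto intro!: has_vector_derivative_diff)
qed

text \<open>Iterating the product rule from \<open>W 0 i j = h (f\<^sup>(\<^sup>i\<^sup>)) (g\<^sup>(\<^sup>j\<^sup>))\<close> avoids the binomial
  coefficients of the Leibniz formula.\<close>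

lemma smooth_curve_bilinear:
  assumes "bounded_bilinear h" "smooth_curve T f" "smooth_curve T g"
  shows "smooth_curve T (\<lambda>t. h (f t) (g t))"
proof -
  obtain D where D: "D 0 = f"
    "\<And>k t. t \<in> {0..T} \<Longrightarrow> (D k has_vector_derivative D (Suc k) t) (at t within {0..T})"
    using assms unfolding smooth_curve_def by blast
  obtain E where E: "E 0 = g"
    "\<And>k t. t \<in> {0..T} \<Longrightarrow> (E k has_vector_derivative E (Suc k) t) (at t within {0..T})"
    using assms unfolding smooth_curve_def by blast
  define W where "W = rec_nat (\<lambda>i j t. h (D i t) (E j t))
    (\<lambda>_ w i j t. w i (Suc j) t + w (Suc i) j t)"
  have W0: "W 0 = (\<lambda>i j t. h (D i t) (E j t))"
    and WSuc: "W (Suc k) = (\<lambda>i j t. W k i (Suc j) t + W k (Suc i) j t)" for k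
    by (simp_all add: W_def)
  have "(W k i j has_vector_derivative W (Suc k) i j t) (at t within {0..T})"
    if "t \<in> {0..T}" for k i j t
  proof (induction k arbitrary: i j)
    case 0
    show ?case
      unfolding W0 WSuc using D E that
      by (auto intro: bounded_bilinear.has_vector_derivative[OF assms(1)])
  next
    case (Suc k)
    show ?case
      by (subst WSuc, subst WSuc) (intro has_vector_derivative_add Suc.IH)
  qed
  then show ?thesis
    unfolding smooth_curve_def
    by (intro exI[of _ "\<lambda>k. W k 0 0"]) (auto simp: W0 D E)
qed

text \<open>Supplies the two factors of the weight \<open>t * (T - t)\<close> in the test
  variation.\<close>

lemma smooth_curve_affine: "smooth_curve T (\<lambda>t. a + t *\<^sub>R b)"
  unfolding smooth_curve_def
  by (rule exI[of _ "\<lambda>k t. if k = 0 then a + t *\<^sub>R b else if k = 1 then b else 0"])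
    (auto intro!: derivative_eq_intros simp: has_vector_derivative_def)

section \<open>The first variation of the action\<close>

lemma velocity_eq:
  fixes f :: "real \<Rightarrow> 'a::euclidean_space"
  assumes "0 < T" "t \<in> {0..T}" "(f has_vector_derivative f') (at t within {0..T})"
  shows "velocity T f t = f'"
  \<comment> \<open>As \<open>0 < T\<close>, the interval has no isolated points, so even the
    one-sided derivatives at its ends are unique.\<close>
  unfolding velocity_def using assms by (rule vector_derivative_within_closed_interval)

lemma trace_mult_transpose_mult:
  "trace (M ** transpose X ** X) = X \<bullet> (X ** (M :: real^'m^'m))"
  by (metis matrix_mul_assoc trace_mul_sym trace_transpose_mult)

text \<open>Along the straight family the action is exactly a quadratic polynomial in \<epsilon>,
  whose linear coefficient is the claimed integral. This avoids differentiating under the integral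
  sign.\<close>

lemma action_has_derivative:
  fixes \<Lambda> :: "real^'N^'N" and Q V :: "real \<Rightarrow> real^'N^'n"
  assumes "0 < T" and \<Lambda>: "transpose \<Lambda> = \<Lambda>"
    and Q: "\<And>t. t \<in> {0..T} \<Longrightarrow> (Q has_vector_derivative Q' t) (at t within {0..T})"
    and V: "\<And>t. t \<in> {0..T} \<Longrightarrow> (V has_vector_derivative V' t) (at t within {0..T})"
    and cont: "continuous_on {0..T} Q'" "continuous_on {0..T} V'"
  shows "((\<lambda>\<epsilon>. action \<Lambda> T (\<lambda>t. Q t + \<epsilon> *\<^sub>R V t)) has_real_derivative
    integral {0..T} (\<lambda>t. (Q' t ** \<Lambda>) \<bullet> V' t)) (at 0)"
proof -
  define a where "a = (\<lambda>t. 1/2 * (Q' t \<bullet> (Q' t ** \<Lambda>)))"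
  define b where "b = (\<lambda>t. (Q' t ** \<Lambda>) \<bullet> V' t)"
  define c where "c = (\<lambda>t. 1/2 * (V' t \<bullet> (V' t ** \<Lambda>)))"
  have int: "a integrable_on {0..T}" "b integrable_on {0..T}" "c integrable_on {0..T}"
    unfolding a_def b_def c_def
    by (intro integrable_continuous_real continuous_intros matrix_mult.continuous_on cont)+
  have "action \<Lambda> T (\<lambda>t. Q t + \<epsilon> *\<^sub>R V t)
      = integral {0..T} a + \<epsilon> * integral {0..T} b + \<epsilon>\<^sup>2 * integral {0..T} c" for \<epsilon>
  proof -
    have "1/2 * trace (\<Lambda> ** transpose (velocity T (\<lambda>t. Q t + \<epsilon> *\<^sub>R V t) t)
        ** velocity T (\<lambda>t. Q t + \<epsilon> *\<^sub>R V t) t) = a t + \<epsilon> * b t + \<epsilon>\<^sup>2 * c t"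
      if t: "t \<in> {0..T}" for t
    proof -
      have "velocity T (\<lambda>t. Q t + \<epsilon> *\<^sub>R V t) t = Q' t + \<epsilon> *\<^sub>R V' t"
        using t assms(1)
        by (intro velocity_eq has_vector_derivative_add Q
            bounded_linear.has_vector_derivative[OF bounded_linear_scaleR_right] V)
      \<comment> \<open>Symmetry of \<Lambda> makes the two cross terms equal; together they cancel
        the factor 1/2 of the action.\<close>
      moreover have "Q' t \<bullet> (V' t ** \<Lambda>) = b t" "V' t \<bullet> (Q' t ** \<Lambda>) = b t"
        using inner_matrix_mult_right[of "V' t" \<Lambda> "Q' t"]
          by (simp_all add: b_def \<Lambda> inner_commute)
      ultimately show ?thesis
        by (simp add: trace_mult_transpose_mult matrix_mult.add_left matrix_mult.scaleR_left
            inner_add_left inner_add_right a_def c_def power2_eq_square algebra_simps)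
    qed
    then have "action \<Lambda> T (\<lambda>t. Q t + \<epsilon> *\<^sub>R V t)
        = integral {0..T} (\<lambda>t. a t + \<epsilon> * b t + \<epsilon>\<^sup>2 * c t)"
      unfolding action_def by (rule integral_cong)
    also have "\<dots> = integral {0..T} a + \<epsilon> * integral {0..T} b + \<epsilon>\<^sup>2 * integral {0..T} c"
      using int by (simp add: integral_add integrable_add integrable_on_mult_right)
    finally show ?thesis .
  qed
  then show ?thesis
    unfolding b_def[symmetric] by (auto intro!: derivative_eq_intros)
qed

text \<open>With \<open>Q'' t ** \<Lambda>\<close> in the role of the derivative of
  \<open>S\<close>, this is the fundamental lemma of the calculus of variations for skew-symmetric
  test functions, which detect only the skew part of a matrix.\<close>

lemma extremal_iff_symmetric:
  fixes \<Lambda> :: "real^'N^'N" and Q :: "real \<Rightarrow> real^'N^'n"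
  assumes "0 < T" and \<Lambda>: "transpose \<Lambda> = \<Lambda>" and adm: "admissible T Q\<^sub>0 Q\<^sub>T Q"
    and smooth: "smooth_curve T Q'" "smooth_curve T Q''"
    and Q: "\<And>t. t \<in> {0..T} \<Longrightarrow> (Q has_vector_derivative Q' t) (at t within {0..T})"
    and Q': "\<And>t. t \<in> {0..T} \<Longrightarrow> (Q' has_vector_derivative Q'' t) (at t within {0..T})"
  shows "extremal \<Lambda> T Q\<^sub>0 Q\<^sub>T Q \<longleftrightarrow>
    (\<forall>t\<in>{0..T}. transpose (Q t) ** (Q'' t ** \<Lambda>) \<in> Sym)"
proof -
  define K where "K = (\<lambda>t. transpose (Q t) ** (Q'' t ** \<Lambda>))"
  have smQ: "smooth_curve T Q"
    using adm by (simp add: admissible_def)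
  have smK: "smooth_curve T K"
    unfolding K_def
    by (intro smooth_curve_bilinear[OF matrix_mult.bounded_bilinear_axioms]
        smooth_curve_bounded_linear[OF bounded_linear_transpose] smQ
        smooth_curve_bounded_linear[OF matrix_mult.bounded_linear_left] smooth)
  have first_variation: "((\<lambda>\<epsilon>. action \<Lambda> T (\<lambda>t. Q t + \<epsilon> *\<^sub>R (Q t ** \<Sigma> t))) has_real_derivative
      - integral {0..T} (\<lambda>t. K t \<bullet> \<Sigma> t)) (at 0)"
    if sm: "smooth_curve T \<Sigma>" and bd: "\<Sigma> 0 = 0" "\<Sigma> T = 0" for \<Sigma> :: "real \<Rightarrow> real^'N^'N"
  proof -
    have "smooth_curve T (\<lambda>t. Q t ** \<Sigma> t)"
      by (intro smooth_curve_bilinear[OF matrix_mult.bounded_bilinear_axioms] smQ sm)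
    then obtain V' where V': "smooth_curve T V'"
      "\<And>t. t \<in> {0..T} \<Longrightarrow> ((\<lambda>t. Q t ** \<Sigma> t) has_vector_derivative V' t) (at t within {0..T})"
      by (rule smooth_curve_derivE) blast
    \<comment> \<open>Integration by parts: the integrand is the derivative of the product of
      \<open>Q' t ** \<Lambda>\<close> and \<open>Q t ** \<Sigma> t\<close>, which vanishes at both
      ends with \<Sigma>.\<close>
    have "((\<lambda>t. (Q' t ** \<Lambda>) \<bullet> V' t + (Q'' t ** \<Lambda>) \<bullet> (Q t ** \<Sigma> t)) has_integral
        (Q' T ** \<Lambda>) \<bullet> (Q T ** \<Sigma> T) - (Q' 0 ** \<Lambda>) \<bullet> (Q 0 ** \<Sigma> 0)) {0..T}"
      using assms(1)
      by (intro fundamental_theorem_of_calculus bounded_bilinear.has_vector_derivative[OF bounded_bilinear_inner]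
          bounded_linear.has_vector_derivative[OF matrix_mult.bounded_linear_left] Q' V') auto
    moreover have "(\<lambda>t. K t \<bullet> \<Sigma> t) integrable_on {0..T}"
      by (intro integrable_continuous_real continuous_intros smooth_curve_imp_continuous_on smK sm)
    moreover have "(Q'' t ** \<Lambda>) \<bullet> (Q t ** \<Sigma> t) = K t \<bullet> \<Sigma> t" for t
      by (metis K_def inner_commute inner_matrix_mult_left)
    ultimately have "((\<lambda>t. (Q' t ** \<Lambda>) \<bullet> V' t + K t \<bullet> \<Sigma> t) has_integral 0) {0..T}"
      and "((\<lambda>t. K t \<bullet> \<Sigma> t) has_integral integral {0..T} (\<lambda>t. K t \<bullet> \<Sigma> t)) {0..T}"
      by (simp_all add: bd integrable_integral)
    from has_integral_diff[OF this]
    have "((\<lambda>t. (Q' t ** \<Lambda>) \<bullet> V' t) has_integral - integral {0..T} (\<lambda>t. K t \<bullet> \<Sigma> t)) {0..T}"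
      by simp
    then show ?thesis
      using action_has_derivative[OF assms(1) \<Lambda> Q V'(2) smooth_curve_imp_continuous_on[OF smooth(1)]
          smooth_curve_imp_continuous_on[OF V'(1)]]
      by (simp add: integral_unique)
  qed
  have "extremal \<Lambda> T Q\<^sub>0 Q\<^sub>T Q \<longleftrightarrow> (\<forall>t\<in>{0..T}. K t \<in> Sym)"
  proof
    assume ext: "extremal \<Lambda> T Q\<^sub>0 Q\<^sub>T Q"
    define R where "R = (\<lambda>t. K t - transpose (K t))"
    define \<Sigma> where "\<Sigma> = (\<lambda>t. (t * (T - t)) *\<^sub>R R t)"
    have skew: "transpose (R t) = - R t" for t
      by (simp add: R_def transpose_diff)
    have smR: "smooth_curve T R"
      unfolding R_def
      by (intro smooth_curve_diff smK smooth_curve_bounded_linear[OF bounded_linear_transpose])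
    have "smooth_curve T (\<lambda>t. t * (T - t))"
      using smooth_curve_bilinear[OF bounded_bilinear_mult smooth_curve_affine[of T 0 1]
          smooth_curve_affine[of T T "-1"]] by simp
    then have sm: "smooth_curve T \<Sigma>"
      unfolding \<Sigma>_def by (intro smooth_curve_bilinear[OF bounded_bilinear_scaleR] smR)
    have bd: "\<Sigma> 0 = 0" "\<Sigma> T = 0"
      by (simp_all add: \<Sigma>_def)
    have "skew_symmetric (\<Sigma> t)" for t
      by (simp add: skew_symmetric_def \<Sigma>_def skew transpose_scalar)
    with ext sm bd
    have "((\<lambda>\<epsilon>. action \<Lambda> T (\<lambda>t. Q t + \<epsilon> *\<^sub>R (Q t ** \<Sigma> t))) has_real_derivative 0) (at 0)"
      by (simp add: extremal_def)
    with first_variation[OF sm bd] have int0: "integral {0..T} (\<lambda>t. K t \<bullet> \<Sigma> t) = 0"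
      using DERIV_unique by fastforce
    \<comment> \<open>\<open>R t\<close> is twice the skew part of \<open>K t\<close>, whence the
      factor 1/2. The integrand is thus a nonnegative weight times a squared norm, and a zero
      integral forces it to vanish pointwise.\<close>
    have K\<Sigma>: "K t \<bullet> \<Sigma> t = 1/2 * (t * (T - t)) * (R t \<bullet> R t)" for t
    proof -
      have "transpose (K t) \<bullet> R t = - (K t \<bullet> R t)"
        using inner_transpose[of "K t" "R t"] by (simp add: skew)
      then have "R t \<bullet> R t = 2 * (K t \<bullet> R t)"
        by (subst (1) R_def) (simp add: inner_diff_left)
      then show ?thesis
        by (simp add: \<Sigma>_def)
    qed
    have "\<forall>t\<in>{0..T}. K t \<bullet> \<Sigma> t = 0"
    proof -
      have "continuous_on {0..T} (\<lambda>t. K t \<bullet> \<Sigma> t)"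
        by (intro continuous_intros smooth_curve_imp_continuous_on smK sm)
      moreover have "0 \<le> K t \<bullet> \<Sigma> t" if "t \<in> {0..T}" for t
        using that by (simp add: K\<Sigma>)
      ultimately show ?thesis
        using integral_eq_0_iff[OF _ assms(1)] int0 by blast
    qed
    then have "K t \<bullet> \<Sigma> t = 0" if "t \<in> {0<..<T}" for t
      using that by simp
    then have R0: "R t = 0" if "t \<in> {0<..<T}" for t
      using that by (auto simp: K\<Sigma>)
    \<comment> \<open>The weight is zero at the ends of the interval, so there \<open>R\<close> is
      reached only by continuity.\<close>
    have "R t = 0" if "t \<in> {0..T}" for t
    proof (rule continuous_constant_on_closure[where f = R and S = "{0<..<T}"])
      show "continuous_on (closure {0<..<T}) R"
        using assms(1) smooth_curve_imp_continuous_on[OF smR] by simp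
    qed (use that assms(1) R0 in auto)
    then show "\<forall>t\<in>{0..T}. K t \<in> Sym"
      by (simp add: R_def Sym_def)
  next
    assume sym: "\<forall>t\<in>{0..T}. K t \<in> Sym"
    show "extremal \<Lambda> T Q\<^sub>0 Q\<^sub>T Q"
      unfolding extremal_def
    proof (intro conjI adm allI impI; elim conjE)
      fix \<Sigma> :: "real \<Rightarrow> real^'N^'N"
      assume \<Sigma>: "smooth_curve T \<Sigma>" "\<forall>t\<in>{0..T}. skew_symmetric (\<Sigma> t)" "\<Sigma> 0 = 0" "\<Sigma> T = 0"
      then have "integral {0..T} (\<lambda>t. K t \<bullet> \<Sigma> t) = integral {0..T} (\<lambda>t. 0)"
        using sym
        by (intro integral_cong inner_symmetric_skew) (auto simp: Sym_def skew_symmetric_def)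
      then show "((\<lambda>\<epsilon>. action \<Lambda> T (\<lambda>t. Q t + \<epsilon> *\<^sub>R (Q t ** \<Sigma> t))) has_real_derivative 0) (at 0)"
        using first_variation[OF \<Sigma>(1,3,4)] by simp
    qed
  qed
  then show ?thesis
    by (simp add: K_def)
qed

section \<open>The Stiefel constraint and the equations of motion\<close>

lemma stiefel_second_derivative:
  fixes Q :: "real \<Rightarrow> real^'N^'n"
  assumes "0 < T" and st: "\<And>t. t \<in> {0..T} \<Longrightarrow> Q t \<in> stiefel"
    and Q: "\<And>t. t \<in> {0..T} \<Longrightarrow> (Q has_vector_derivative Q' t) (at t within {0..T})"
    and Q': "\<And>t. t \<in> {0..T} \<Longrightarrow> (Q' has_vector_derivative Q'' t) (at t within {0..T})"
    and t: "t \<in> {0..T}"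
  shows "Q'' t ** transpose (Q t) + Q t ** transpose (Q'' t)
    = - 2 *\<^sub>R (Q' t ** transpose (Q' t))"
proof -
  note tr = bounded_linear.has_vector_derivative[OF bounded_linear_transpose]
  have zero: "f' = 0"
    if "\<And>s. s \<in> {0..T} \<Longrightarrow> f s = c" "(f has_vector_derivative f') (at s within {0..T})"
      "s \<in> {0..T}" for f :: "real \<Rightarrow> real^'n^'n" and f' c s
    using vector_derivative_unique_within_closed_interval[of 0 T s f f' 0] that assms(1)
      has_vector_derivative_transform[of s "{0..T}" f "\<lambda>_. c" 0] by auto
  have 1: "Q s ** transpose (Q' s) + Q' s ** transpose (Q s) = 0" if "s \<in> {0..T}" for s
  proof (rule zero)
    show "((\<lambda>s. Q s ** transpose (Q s)) has_vector_derivative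
        Q s ** transpose (Q' s) + Q' s ** transpose (Q s)) (at s within {0..T})"
      by (intro matrix_mult.has_vector_derivative tr Q that)
  qed (use st that in \<open>auto simp: stiefel_def\<close>)
  \<comment> \<open>The first-order relation is again constant on the whole interval, so it can be
    differentiated once more, one-sidedly at the ends.\<close>
  have "(Q t ** transpose (Q'' t) + Q' t ** transpose (Q' t))
      + (Q' t ** transpose (Q' t) + Q'' t ** transpose (Q t)) = 0"
  proof (rule zero)
    show "((\<lambda>s. Q s ** transpose (Q' s) + Q' s ** transpose (Q s)) has_vector_derivative
        (Q t ** transpose (Q'' t) + Q' t ** transpose (Q' t))
        + (Q' t ** transpose (Q' t) + Q'' t ** transpose (Q t))) (at t within {0..T})"
      by (intro has_vector_derivative_add matrix_mult.has_vector_derivative tr Q Q' t)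
  qed (use t 1 in auto)
  then show ?thesis
    by (simp only: scaleR_minus_left scaleR_2 eq_neg_iff_add_eq_0 ac_simps)
qed

text \<open>Reconciles the two expressions for \<open>E\<close>: \<open>X\<close> is
  \<open>S ** matrix_inv \<Lambda>\<close>, and the symmetric inverse then occurs twice in
  \<open>X ** transpose X\<close>.\<close>

lemma velocity_E_mat:
  assumes "positive_definite \<Lambda>" "S = X ** \<Lambda>"
  shows "- 2 *\<^sub>R (X ** transpose X) = E_mat \<Lambda> S"
proof -
  note inv = positive_definite_mult_inv[OF assms(1)]
  have "S ** matrix_inv \<Lambda> = X"
    by (simp add: assms(2) inv flip: matrix_mul_assoc)
  moreover have "transpose (matrix_inv \<Lambda>) = matrix_inv \<Lambda>"
    using positive_definite_matrix_inv[OF assms(1)] by (simp add: positive_definite_def)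
  ultimately have "transpose X = matrix_inv \<Lambda> ** transpose S"
    by (metis matrix_transpose_mul)
  then show ?thesis
    using \<open>S ** matrix_inv \<Lambda> = X\<close> by (simp add: E_mat_def matrix_mul_assoc)
qed

text \<open>The pointwise linear algebra, with \<open>X\<close> and \<open>Y\<close> standing for
  the first and second derivatives of the curve and \<open>tangent\<close> for its twice
  differentiated constraint.\<close>

lemma symmetric_iff_B_mat:
  fixes \<Lambda> :: "real^'N^'N" and Q X Y :: "real^'N^'n"
  assumes pd: "positive_definite \<Lambda>" and Q: "Q \<in> stiefel"
    and tangent: "Y ** transpose Q + Q ** transpose Y = - 2 *\<^sub>R (X ** transpose X)"
  shows "transpose Q ** (Y ** \<Lambda>) \<in> Sym \<longleftrightarrow> Y ** \<Lambda> = B_mat \<Lambda> Q (X ** \<Lambda>) ** Q"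
proof
  note inv = positive_definite_mult_inv[OF pd]
  have QQ: "Q ** transpose Q = mat 1"
    using Q by (simp add: stiefel_def)
  define Z where "Z = Y ** \<Lambda>"
  \<comment> \<open>The only candidate: if \<open>Z = B ** Q\<close> with \<open>B\<close>
    symmetric, then \<open>Q ** transpose Z = B\<close>.\<close>
  define B where "B = Q ** transpose Z"
  assume "transpose Q ** (Y ** \<Lambda>) \<in> Sym"
  then have sym: "transpose Z ** Q = transpose Q ** Z"
    by (simp add: Sym_def Z_def[symmetric] matrix_transpose_mul)
  have Z: "Z = B ** Q"
    by (metis B_def QQ matrix_mul_assoc matrix_mul_lid sym)
  have "transpose B = Z ** transpose Q"
    by (simp add: B_def matrix_transpose_mul)
  also have "\<dots> = B"
    by (simp add: Z QQ flip: matrix_mul_assoc)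
  finally have B: "B \<in> Sym"
    by (simp add: Sym_def)
  have Linv: "transpose (matrix_inv \<Lambda>) = matrix_inv \<Lambda>"
    using positive_definite_matrix_inv[OF pd] by (simp add: positive_definite_def)
  have Y: "Y = B ** Q ** matrix_inv \<Lambda>"
    using Z by (simp add: Z_def inv flip: matrix_mul_assoc) (metis inv(1) matrix_mul_assoc matrix_mul_rid)
  \<comment> \<open>After solving for \<open>Y\<close>, the two summands of \<open>J_op\<close> are
    exactly the two terms on the left of the constraint.\<close>
  have "J_op \<Lambda> Q B = Y ** transpose Q + Q ** transpose Y"
    using B by (simp add: J_op_def Y matrix_transpose_mul Linv Sym_def matrix_mul_assoc add.commute)
  then have "J_op \<Lambda> Q B = E_mat \<Lambda> (X ** \<Lambda>)"
    using tangent velocity_E_mat[OF pd refl] by metis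
  then have "B_mat \<Lambda> Q (X ** \<Lambda>) = B"
    using bij_betw_J_op[OF pd Q] B unfolding B_mat_def
    by (metis bij_betw_def inv_into_f_f)
  then show "Y ** \<Lambda> = B_mat \<Lambda> Q (X ** \<Lambda>) ** Q"
    using Z by (simp add: Z_def)
next
  assume eq: "Y ** \<Lambda> = B_mat \<Lambda> Q (X ** \<Lambda>) ** Q"
  \<comment> \<open>\<open>inv_into\<close> is known to land in \<open>Sym\<close> only for
    arguments in the image of \<open>Sym\<close>, which is \<open>Sym\<close> itself.\<close>
  have "E_mat \<Lambda> (X ** \<Lambda>) \<in> Sym"
    by (simp add: Sym_def transpose_minus transpose_scalar matrix_transpose_mul flip: velocity_E_mat[OF pd refl])
  then have "B_mat \<Lambda> Q (X ** \<Lambda>) \<in> Sym"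
    unfolding B_mat_def using bij_betw_J_op[OF pd Q]
    by (metis bij_betw_def inv_into_into)
  then show "transpose Q ** (Y ** \<Lambda>) \<in> Sym"
    by (simp add: eq Sym_def matrix_transpose_mul matrix_mul_assoc)
qed

text \<open>The first equation at each time says that \<open>S\<close> is the velocity times
  \<Lambda>. Once this holds on the whole interval, the second equation is pointwise equivalent to
  the symmetry condition for extremals.\<close>

lemma extremal_iff_geodesic_equations:
  fixes \<Lambda> :: "real^'N^'N" and Q S :: "real \<Rightarrow> real^'N^'n"
  assumes pd: "positive_definite \<Lambda>" and "0 < T" and adm: "admissible T Q\<^sub>0 Q\<^sub>T Q"
  shows "extremal \<Lambda> T Q\<^sub>0 Q\<^sub>T Q \<and> (\<forall>t\<in>{0..T}. S t = velocity T Q t ** \<Lambda>) \<longleftrightarrow>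
    (\<forall>t\<in>{0..T}.
      (Q has_vector_derivative S t ** matrix_inv \<Lambda>) (at t within {0..T}) \<and>
      (S has_vector_derivative B_mat \<Lambda> (Q t) (S t) ** Q t) (at t within {0..T}))"
    (is "?ext \<and> ?vel \<longleftrightarrow> (\<forall>t\<in>?I. ?dQ t \<and> ?dS t)")
proof -
  note inv = positive_definite_mult_inv[OF pd]
  have st: "Q t \<in> stiefel" if "t \<in> {0..T}" for t
    using adm that by (simp add: admissible_def)
  obtain Q' where Q': "smooth_curve T Q'"
    "\<And>t. t \<in> {0..T} \<Longrightarrow> (Q has_vector_derivative Q' t) (at t within {0..T})"
    using adm smooth_curve_derivE unfolding admissible_def by metis
  obtain Q'' where Q'': "smooth_curve T Q''"
    "\<And>t. t \<in> {0..T} \<Longrightarrow> (Q' has_vector_derivative Q'' t) (at t within {0..T})"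
    using Q'(1) smooth_curve_derivE by metis
  have vel: "velocity T Q t = Q' t" if "t \<in> {0..T}" for t
    using velocity_eq[OF assms(2) that Q'(2)[OF that]] .
  have dQ_iff: "?dQ t \<longleftrightarrow> S t = Q' t ** \<Lambda>" if t: "t \<in> {0..T}" for t
  proof
    assume "?dQ t"
    then have "S t ** matrix_inv \<Lambda> = Q' t"
      using velocity_eq[OF assms(2) t] vel[OF t] by metis
    then show "S t = Q' t ** \<Lambda>"
      by (metis inv(2) matrix_mul_assoc matrix_mul_rid)
  next
    assume "S t = Q' t ** \<Lambda>"
    then show "?dQ t"
      using Q'(2)[OF t] by (simp add: inv flip: matrix_mul_assoc)
  qed
  have dS_iff: "?dS t \<longleftrightarrow> transpose (Q t) ** (Q'' t ** \<Lambda>) \<in> Sym"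
    if S: "\<forall>t\<in>{0..T}. S t = Q' t ** \<Lambda>" and t: "t \<in> {0..T}" for t
  proof -
    \<comment> \<open>\<open>S\<close> is an arbitrary function; its differentiability within the
      interval is inherited from the curve with which it agrees there.\<close>
    have "(S has_vector_derivative Q'' t ** \<Lambda>) (at t within {0..T})"
      using S t Q''(2)
      by (intro has_vector_derivative_transform[of t _ S "\<lambda>t. Q' t ** \<Lambda>"]
          bounded_linear.has_vector_derivative[OF matrix_mult.bounded_linear_left]) auto
    then have "?dS t \<longleftrightarrow> Q'' t ** \<Lambda> = B_mat \<Lambda> (Q t) (S t) ** Q t"
      using velocity_eq[OF assms(2) t] by metis
    then show ?thesis
      using symmetric_iff_B_mat[OF pd st[OF t] stiefel_second_derivative[OF assms(2) st Q'(2) Q''(2) t]]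
        S t by simp
  qed
  have "?ext \<longleftrightarrow> (\<forall>t\<in>{0..T}. transpose (Q t) ** (Q'' t ** \<Lambda>) \<in> Sym)"
    using pd by (intro extremal_iff_symmetric[OF assms(2) _ adm Q'(1) Q''(1) Q'(2) Q''(2)])
      (auto simp: positive_definite_def)
  then show ?thesis
    using dQ_iff dS_iff vel by (metis (no_types, lifting))
qed

text \<open>The first conjunct makes the \<open>inv_into\<close> inside \<open>B_mat\<close> a
  genuine inverse. In the second, admissibility on the right supplies the smoothness, the constraint
  and the endpoint values, and the third identifies the two forms of \<open>E\<close>.\<close>

theorem proposition2:
  fixes \<Lambda> :: "real^'N^'N" and T :: real and Q\<^sub>0 Q\<^sub>T :: "real^'N^'n"
  assumes "CARD('n) \<le> CARD('N)"
    and "diagonal_matrix \<Lambda>" and "positive_definite \<Lambda>"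
    and "0 < T"
  shows "(\<forall>P \<in> (stiefel :: (real^'N^'n) set). bij_betw (J_op \<Lambda> P) Sym Sym) \<and>
    (\<forall>(Q :: real \<Rightarrow> real^'N^'n) S.
       extremal \<Lambda> T Q\<^sub>0 Q\<^sub>T Q \<and> (\<forall>t\<in>{0..T}. S t = velocity T Q t ** \<Lambda>)
       \<longleftrightarrow>
       admissible T Q\<^sub>0 Q\<^sub>T Q \<and>
       (\<forall>t\<in>{0..T}.
          (Q has_vector_derivative S t ** matrix_inv \<Lambda>) (at t within {0..T}) \<and>
          (S has_vector_derivative B_mat \<Lambda> (Q t) (S t) ** Q t) (at t within {0..T}))) \<and>
    (\<forall>(Q :: real \<Rightarrow> real^'N^'n) S. \<forall>t\<in>{0..T}.
       S t = velocity T Q t ** \<Lambda> \<longrightarrow>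
       - 2 *\<^sub>R (velocity T Q t ** transpose (velocity T Q t)) = E_mat \<Lambda> (S t))"
proof (intro conjI allI ballI impI)
  fix P :: "real^'N^'n" assume "P \<in> stiefel"
  then show "bij_betw (J_op \<Lambda> P) Sym Sym"
    using assms(3) by (rule bij_betw_J_op[rotated])
next
  fix Q S :: "real \<Rightarrow> real^'N^'n"
  show "extremal \<Lambda> T Q\<^sub>0 Q\<^sub>T Q \<and> (\<forall>t\<in>{0..T}. S t = velocity T Q t ** \<Lambda>) \<longleftrightarrow>
    admissible T Q\<^sub>0 Q\<^sub>T Q \<and>
    (\<forall>t\<in>{0..T}.
      (Q has_vector_derivative S t ** matrix_inv \<Lambda>) (at t within {0..T}) \<and>
      (S has_vector_derivative B_mat \<Lambda> (Q t) (S t) ** Q t) (at t within {0..T}))"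
    \<comment> \<open>Being extremal includes admissibility, so the preceding equivalence is
      available from either side.\<close>
    using extremal_iff_geodesic_equations[OF assms(3,4)]
    by (metis (no_types, lifting) extremal_def)
next
  fix Q S :: "real \<Rightarrow> real^'N^'n" and t
  assume "S t = velocity T Q t ** \<Lambda>"
  then show "- 2 *\<^sub>R (velocity T Q t ** transpose (velocity T Q t)) = E_mat \<Lambda> (S t)"
    by (rule velocity_E_mat[OF assms(3)])
qed

end
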